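(* Consider signed groups that admit an anticommutative generator of length $n$ (such a group has order $2^{n+1}$ when $n$ is finite). Up to isomorphism of signed groups: (1) if $n\ge2$ is even, there are exactly two non-isomorphic such groups; (2) if $n\ge2$ is odd, there are exactly three non-isomorphic such groups; (3) if $n=\infty$ (a countably infinite anticommutative generator), there is only one such signed group.
   Context: A signed group is a group containing a central element $-1\neq1$ with $(-1)^2=1$ such that any two elements either commute or anticommute ($ef=-fe$) and each element $e$ has signature $e^2\in\{\pm1\}$. For a sequence $\mathbf e$ and finitary $0$-$1$ sequence $\mathbf p$, $\mathbf e^{\mathbf p}=e_1^{p_1}e_2^{p_2}\cdots$. A sequence is basic if no $\mathbf e^{\mathbf p}$ with $\mathbf p\ne\mathbf 0$ equals $\pm1$; a generator is a basic sequence, and it generates the group $\{\pm\mathbf e^{\mathbf p}\}$. An anticommutative generator is one whose distinct terms pairwise anticommute; the signatures of its terms are arbitrary. Isomorphisms of signed groups are group isomorphisms sending $-1$ to $-1$. *)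

theory Defs
  imports "HOL-Algebra.Group"
begin

definition signed_group :: "'a monoid \<Rightarrow> 'a \<Rightarrow> bool" where
  "signed_group G m \<longleftrightarrow> group G \<and> m \<in> carrier G \<and> m \<noteq> \<one>\<^bsub>G\<^esub> \<and> m \<otimes>\<^bsub>G\<^esub> m = \<one>\<^bsub>G\<^esub> \<and>
     (\<forall>x\<in>carrier G. m \<otimes>\<^bsub>G\<^esub> x = x \<otimes>\<^bsub>G\<^esub> m) \<and>
     (\<forall>x\<in>carrier G. \<forall>y\<in>carrier G. x \<otimes>\<^bsub>G\<^esub> y = y \<otimes>\<^bsub>G\<^esub> x \<or> x \<otimes>\<^bsub>G\<^esub> y = m \<otimes>\<^bsub>G\<^esub> (y \<otimes>\<^bsub>G\<^esub> x)) \<and>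
     (\<forall>x\<in>carrier G. x \<otimes>\<^bsub>G\<^esub> x = \<one>\<^bsub>G\<^esub> \<or> x \<otimes>\<^bsub>G\<^esub> x = m)"

text \<open>The product e^p, where the finitary 0-1 sequence p is represented by its
  (finite) support S; factors are taken in increasing order of index.\<close>
definition seq_pow :: "'a monoid \<Rightarrow> (nat \<Rightarrow> 'a) \<Rightarrow> nat set \<Rightarrow> 'a" where
  "seq_pow G e S = foldr (\<lambda>i acc. e i \<otimes>\<^bsub>G\<^esub> acc) (sorted_list_of_set S) \<one>\<^bsub>G\<^esub>"

text \<open>A sequence indexed by I (I = {..<n} for length n, UNIV for countably
  infinite length) is basic if no nonzero e^p equals 1 or -1.\<close>
definition basic_seq :: "'a monoid \<Rightarrow> 'a \<Rightarrow> (nat \<Rightarrow> 'a) \<Rightarrow> nat set \<Rightarrow> bool" where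
  "basic_seq G m e I \<longleftrightarrow> (\<forall>S. finite S \<and> S \<subseteq> I \<and> S \<noteq> {} \<longrightarrow>
      seq_pow G e S \<noteq> \<one>\<^bsub>G\<^esub> \<and> seq_pow G e S \<noteq> m)"

definition is_generator :: "'a monoid \<Rightarrow> 'a \<Rightarrow> (nat \<Rightarrow> 'a) \<Rightarrow> nat set \<Rightarrow> bool" where
  "is_generator G m e I \<longleftrightarrow> (\<forall>i\<in>I. e i \<in> carrier G) \<and> basic_seq G m e I \<and>
     carrier G = {seq_pow G e S | S. finite S \<and> S \<subseteq> I}
               \<union> {m \<otimes>\<^bsub>G\<^esub> seq_pow G e S | S. finite S \<and> S \<subseteq> I}"

definition is_ac_generator :: "'a monoid \<Rightarrow> 'a \<Rightarrow> (nat \<Rightarrow> 'a) \<Rightarrow> nat set \<Rightarrow> bool" where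
  "is_ac_generator G m e I \<longleftrightarrow> is_generator G m e I \<and>
     (\<forall>i\<in>I. \<forall>j\<in>I. i \<noteq> j \<longrightarrow> e i \<otimes>\<^bsub>G\<^esub> e j = m \<otimes>\<^bsub>G\<^esub> (e j \<otimes>\<^bsub>G\<^esub> e i))"

definition has_ac_generator :: "'a monoid \<Rightarrow> 'a \<Rightarrow> nat set \<Rightarrow> bool" where
  "has_ac_generator G m I \<longleftrightarrow> (\<exists>e. is_ac_generator G m e I)"

definition signed_iso :: "'a monoid \<Rightarrow> 'a \<Rightarrow> 'b monoid \<Rightarrow> 'b \<Rightarrow> bool" where
  "signed_iso G m H m' \<longleftrightarrow> (\<exists>h. h \<in> iso G H \<and> h m = m')"

end

theory Submission
  imports Defs "HOL-Algebra.Coset" "HOL-Library.Nat_Bijection" "HOL-Library.Infinite_Set" Complex_Main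
begin

text \<open>A signed group with an anticommutative generator is determined by the signatures of the
  terms. Multiplying all other terms by one term of square 1 turns \<open>q\<close> negative signatures
  out of \<open>n\<close> into \<open>n - 1 - q\<close>, and multiplying four terms of equal signature by their product
  flips these four. This leaves two or three values of \<open>q\<close> near \<open>n/2\<close>, and in the infinite case
  reaches infinitely many terms of both signatures. The remaining finite
  groups differ in the number of elements of square 1, which is read off from the complex
  number \<open>(1 - \<i>)^q (1 + \<i>)^(n - q)\<close>.\<close>

text \<open>Why exactly two or three classes: in polar form, Re z + Im z for z = (1-i)^q (1+i)^(n-q)
  equals 2^((n+1)/2) cos(pi (n-1-2q)/4). Passing from q to n-1-q changes the sign of n-1-2q, and
  flipping four equal signatures shifts it by 8, so the cosine survives both moves. For even n the
  number n-1-2q is odd and the cosine is +-1/sqrt 2; for odd n it is even and the cosine is 1, 0 or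
  -1. The obstacle is to show that each modified sequence is again a generator. All sign bookkeeping
  is therefore done once, in a model made of signed finite index sets. A sequence with the right
  relations yields a homomorphism from the model, and being a generator amounts to bijectivity of
  that homomorphism.\<close>

section \<open>Symmetric differences and the sign form of anticommuting products\<close>

definition symdiff :: "'a set \<Rightarrow> 'a set \<Rightarrow> 'a set" (infixl "\<triangle>" 65) where
  "S \<triangle> T = {x. x \<in> S \<longleftrightarrow> x \<notin> T}"

lemma symdiff_simps [simp]: "S \<triangle> {} = S" "{} \<triangle> S = S" "S \<triangle> S = {}"
  by (auto simp: symdiff_def)

lemma symdiff_assoc: "(S \<triangle> T) \<triangle> U = S \<triangle> (T \<triangle> U)"
  by (auto simp: symdiff_def)

lemma symdiff_commute: "S \<triangle> T = T \<triangle> S"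
  by (auto simp: symdiff_def)

lemma insert_eq_symdiff: "i \<notin> S \<Longrightarrow> insert i S = {i} \<triangle> S"
  by (auto simp: symdiff_def)

lemma finite_symdiff [simp]: "finite S \<Longrightarrow> finite T \<Longrightarrow> finite (S \<triangle> T)"
  by (rule finite_subset[of _ "S \<union> T"]) (auto simp: symdiff_def)

lemma symdiff_subset: "S \<subseteq> I \<Longrightarrow> T \<subseteq> I \<Longrightarrow> S \<triangle> T \<subseteq> I"
  by (auto simp: symdiff_def)

lemma odd_card_symdiff:
  assumes "finite S" "finite T"
  shows "odd (card (S \<triangle> T)) \<longleftrightarrow> (odd (card S) \<noteq> odd (card T))"
proof -
  have "card (S \<triangle> T) = card (S - T) + card (T - S)"
    using assms by (subst card_Un_disjoint[symmetric]) (auto simp: symdiff_def intro!: arg_cong[where f=card])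
  moreover have "card S = card (S - T) + card (S \<inter> T)" "card T = card (T - S) + card (S \<inter> T)"
    using assms by (metis Int_commute add.commute card_Int_Diff)+
  ultimately show ?thesis by auto
qed

text \<open>\<open>tw s S T\<close> is the exponent of \<open>-1\<close> in \<open>e^S e^T = \<plusminus>e^(S \<triangle> T)\<close> for anticommuting terms,
  where \<open>s\<close> marks the terms of square \<open>-1\<close>: one sign for every pair that has to be swapped
  and one for every such square. It is bilinear over the field of two elements.\<close>

definition pairs :: "(nat \<Rightarrow> bool) \<Rightarrow> nat set \<Rightarrow> nat set \<Rightarrow> (nat \<times> nat) set" where
  "pairs s S T = {(i, j). i \<in> S \<and> j \<in> T \<and> (j < i \<or> i = j \<and> s i)}"

definition tw :: "(nat \<Rightarrow> bool) \<Rightarrow> nat set \<Rightarrow> nat set \<Rightarrow> bool" where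
  "tw s S T = odd (card (pairs s S T))"

lemma finite_pairs: "finite S \<Longrightarrow> finite T \<Longrightarrow> finite (pairs s S T)"
  by (rule finite_subset[of _ "S \<times> T"]) (auto simp: pairs_def)

lemma tw_empty [simp]: "tw s {} T = False" "tw s S {} = False"
  by (simp_all add: tw_def pairs_def)

lemma tw_symdiff_left:
  assumes "finite S" "finite T" "finite U"
  shows "tw s (S \<triangle> T) U \<longleftrightarrow> (tw s S U \<noteq> tw s T U)"
proof -
  have "pairs s (S \<triangle> T) U = pairs s S U \<triangle> pairs s T U"
    by (auto simp: pairs_def symdiff_def)
  then show ?thesis
    using assms by (simp add: tw_def odd_card_symdiff finite_pairs)
qed

lemma tw_symdiff_right:
  assumes "finite S" "finite T" "finite U"
  shows "tw s U (S \<triangle> T) \<longleftrightarrow> (tw s U S \<noteq> tw s U T)"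
proof -
  have "pairs s U (S \<triangle> T) = pairs s U S \<triangle> pairs s U T"
    by (auto simp: pairs_def symdiff_def)
  then show ?thesis
    using assms by (simp add: tw_def odd_card_symdiff finite_pairs)
qed

lemma tw_less: "(\<And>i j. i \<in> S \<Longrightarrow> j \<in> T \<Longrightarrow> i < j) \<Longrightarrow> tw s S T = False"
proof -
  assume "\<And>i j. i \<in> S \<Longrightarrow> j \<in> T \<Longrightarrow> i < j"
  then have "pairs s S T = {}" by (fastforce simp: pairs_def)
  then show ?thesis by (simp add: tw_def)
qed

lemma tw_singleton [simp]: "tw s {i} {j} \<longleftrightarrow> j < i \<or> i = j \<and> s i"
proof -
  have "pairs s {i} {j} = (if j < i \<or> i = j \<and> s i then {(i, j)} else {})"
    by (auto simp: pairs_def)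
  then show ?thesis by (simp add: tw_def)
qed

text \<open>This is the exponent of -1 in \<open>e^S e^T = +-e^T e^S\<close>. One side counts the
  pairs of \<open>S \<times> T\<close> above the diagonal, the other those below it. The diagonal
  pairs with \<open>s i\<close> occur on both sides and cancel, so everything off the diagonal
  remains.\<close>

lemma tw_swap:
  assumes "finite S" "finite T"
  shows "tw s S T \<noteq> tw s T S \<longleftrightarrow> odd (card S * card T + card (S \<inter> T))"
proof -
  define P where "P = pairs s S T"
  define Q where "Q = (\<lambda>(i, j). (j, i)) ` pairs s T S"
  have fin: "finite P" "finite Q" using assms by (auto simp: P_def Q_def finite_pairs)
  have "card Q = card (pairs s T S)"
    unfolding Q_def by (rule card_image) (auto simp: inj_on_def)
  then have "tw s S T \<noteq> tw s T S \<longleftrightarrow> odd (card (P \<triangle> Q))"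
    using fin by (simp add: odd_card_symdiff tw_def P_def)
  also have "P \<triangle> Q = (S \<times> T) \<triangle> ((\<lambda>i. (i, i)) ` (S \<inter> T))"
  proof -
    have "x \<in> Q \<longleftrightarrow> fst x \<in> S \<and> snd x \<in> T \<and> (fst x < snd x \<or> fst x = snd x \<and> s (fst x))" for x
      by (cases x) (auto simp: Q_def pairs_def image_iff)
    then show ?thesis
      by (auto simp: P_def pairs_def symdiff_def)
  qed
  also have "odd (card \<dots>) \<longleftrightarrow> odd (card S * card T + card (S \<inter> T))"
    using assms by (subst odd_card_symdiff) (auto simp: card_cartesian_product card_image inj_on_def)
  finally show ?thesis .
qed

text \<open>Squaring \<open>e_i e^S\<close> gives the squares of both factors and one swap of
  \<open>e_i\<close> with each term of \<open>e^S\<close>.\<close>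

lemma tw_insert_self:
  assumes "finite S" "i \<notin> S"
  shows "tw s (insert i S) (insert i S) \<longleftrightarrow> (s i \<noteq> (tw s S S \<noteq> odd (card S)))"
proof -
  have "tw s {i} S \<noteq> tw s S {i} \<longleftrightarrow> odd (card S)"
    using assms by (subst tw_swap) auto
  then show ?thesis
    using assms by (auto simp: insert_eq_symdiff[of i S] tw_symdiff_left tw_symdiff_right)
qed

section \<open>The model: signed finite sets with twisted multiplication\<close>

text \<open>A signed finite set is coded by a natural number whose lowest bit is the sign. The model
  thus lives on \<open>nat\<close>, the type of the representatives in the theorem, for finite and
  infinite index sets alike.\<close>

definition enc :: "bool \<Rightarrow> nat set \<Rightarrow> nat" where
  "enc a S = 2 * set_encode S + of_bool a"

definition neg :: "nat \<Rightarrow> bool" where "neg x = odd x"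

definition supp :: "nat \<Rightarrow> nat set" where "supp x = set_decode (x div 2)"

lemma neg_enc [simp]: "neg (enc a S) = a"
  by (simp add: neg_def enc_def)

lemma supp_enc [simp]: "finite S \<Longrightarrow> supp (enc a S) = S"
  by (simp add: supp_def enc_def)

lemma enc_neg_supp [simp]: "enc (neg x) (supp x) = x"
  by (simp add: neg_def supp_def enc_def)

lemma finite_supp [simp]: "finite (supp x)"
  by (simp add: supp_def)

lemma neg_supp_eqI:
  assumes "neg x = neg y" "supp x = supp y"
  shows "x = y"
proof -
  have "enc (neg x) (supp x) = enc (neg y) (supp y)" by (simp only: assms)
  then show ?thesis by (simp only: enc_neg_supp)
qed

text \<open>The group of signed basis monomials of a Clifford algebra: the extension of the finite
  subsets of \<open>I\<close> under symmetric difference by {1, -1}, with cocycle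
  \<open>tw s\<close>. Only the multiplication depends on \<open>s\<close>, not the carrier.\<close>

definition clifford :: "nat set \<Rightarrow> (nat \<Rightarrow> bool) \<Rightarrow> nat monoid" where
  "clifford I s = \<lparr>carrier = {x. supp x \<subseteq> I},
     mult = \<lambda>x y. enc (neg x \<noteq> (neg y \<noteq> tw s (supp x) (supp y))) (supp x \<triangle> supp y),
     one = enc False {}\<rparr>"

definition minus_one :: nat where "minus_one = enc True {}"

lemma supp_one [simp]: "supp \<one>\<^bsub>clifford I s\<^esub> = {}" "neg \<one>\<^bsub>clifford I s\<^esub> = False"
  by (simp_all add: clifford_def)

lemma minus_one_simps [simp]: "supp minus_one = {}" "neg minus_one = True"
  by (simp_all add: minus_one_def)

lemma clifford_mult [simp]:
  "neg (x \<otimes>\<^bsub>clifford I s\<^esub> y) \<longleftrightarrow> (neg x \<noteq> (neg y \<noteq> tw s (supp x) (supp y)))"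
  "supp (x \<otimes>\<^bsub>clifford I s\<^esub> y) = supp x \<triangle> supp y"
  by (simp_all add: clifford_def)

lemma clifford_carrier: "x \<in> carrier (clifford I s) \<longleftrightarrow> supp x \<subseteq> I"
  by (simp add: clifford_def)

lemma clifford_eq_iff: "(x :: nat) = y \<longleftrightarrow> supp x = supp y \<and> neg x = neg y"
  using neg_supp_eqI by blast

text \<open>Associativity is the cocycle identity for \<open>tw s\<close>, which follows from
  bilinearity. The inverse of an element has the same support, since every square is 1 or
  -1.\<close>

lemma group_clifford: "group (clifford I s)"
proof (rule groupI)
  fix x assume x: "x \<in> carrier (clifford I s)"
  show "\<exists>y\<in>carrier (clifford I s). y \<otimes>\<^bsub>clifford I s\<^esub> x = \<one>\<^bsub>clifford I s\<^esub>"
    using x by (intro bexI[of _ "enc (neg x \<noteq> tw s (supp x) (supp x)) (supp x)"])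
      (auto simp: clifford_eq_iff[of "_ \<otimes>\<^bsub>clifford I s\<^esub> _"] clifford_carrier)
qed (auto simp: clifford_carrier symdiff_assoc symdiff_subset tw_symdiff_left tw_symdiff_right
      clifford_eq_iff[of "_ \<otimes>\<^bsub>clifford I s\<^esub> _"])

lemma signed_group_clifford: "signed_group (clifford I s) minus_one"
  unfolding signed_group_def
  by (auto simp: group_clifford clifford_carrier clifford_eq_iff[of "_ \<otimes>\<^bsub>clifford I s\<^esub> _"]
      clifford_eq_iff[of minus_one] symdiff_commute)

lemma sorted_list_of_set_insert_min:
  assumes "finite T" "\<forall>j\<in>T. t < j"
  shows "sorted_list_of_set (insert t T) = t # sorted_list_of_set T"
proof -
  have "T - {t} = T" using assms by auto
  then show ?thesis
    using assms by (auto simp: less_imp_le intro: insort_is_Cons)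
qed

lemma seq_pow_empty [simp]: "seq_pow G e {} = \<one>\<^bsub>G\<^esub>"
  by (simp add: seq_pow_def)

lemma seq_pow_insert_min:
  "finite T \<Longrightarrow> \<forall>j\<in>T. t < j \<Longrightarrow> seq_pow G e (insert t T) = e t \<otimes>\<^bsub>G\<^esub> seq_pow G e T"
  by (simp add: seq_pow_def sorted_list_of_set_insert_min
      del: sorted_list_of_set_insert_remove)

lemma seq_pow_clifford:
  "finite S \<Longrightarrow> seq_pow (clifford I s) (\<lambda>i. enc False {i}) S = enc False S"
proof (induction S rule: finite_linorder_min_induct)
  case empty
  then show ?case by (simp add: clifford_def)
next
  case (insert b A)
  have "insert b A = {b} \<triangle> A" using insert by (intro insert_eq_symdiff) auto
  moreover have "seq_pow (clifford I s) (\<lambda>i. enc False {i}) (insert b A) =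
      enc False {b} \<otimes>\<^bsub>clifford I s\<^esub> enc False A"
    using insert by (simp add: seq_pow_insert_min)
  moreover have "tw s {b} A = False" using insert by (intro tw_less) auto
  then have "enc False {b} \<otimes>\<^bsub>clifford I s\<^esub> enc False A = enc False ({b} \<triangle> A)"
    using insert by (simp add: clifford_eq_iff[of "_ \<otimes>\<^bsub>clifford I s\<^esub> _"])
  ultimately show ?case by simp
qed

definition ac_generator_sig :: "'a monoid \<Rightarrow> 'a \<Rightarrow> (nat \<Rightarrow> 'a) \<Rightarrow> nat set \<Rightarrow> (nat \<Rightarrow> bool) \<Rightarrow> bool" where
  "ac_generator_sig G m e I s \<longleftrightarrow> is_ac_generator G m e I \<and>
     (\<forall>i\<in>I. e i \<otimes>\<^bsub>G\<^esub> e i = (if s i then m else \<one>\<^bsub>G\<^esub>))"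

lemma carrier_clifford:
  "carrier (clifford I s) = {enc False S |S. finite S \<and> S \<subseteq> I} \<union> {enc True S |S. finite S \<and> S \<subseteq> I}"
proof -
  have *: "(\<exists>S. x = enc False S \<and> finite S \<and> S \<subseteq> I) \<or> (\<exists>S. x = enc True S \<and> finite S \<and> S \<subseteq> I)"
    if "supp x \<subseteq> I" for x
    using that enc_neg_supp[of x] finite_supp[of x] by (cases "neg x") metis+
  show ?thesis
    by (auto simp: clifford_carrier dest!: *)
qed

lemma clifford_generator: "ac_generator_sig (clifford I s) minus_one (\<lambda>i. enc False {i}) I s"
proof -
  have *: "seq_pow (clifford I s) (\<lambda>i. enc False {i}) S = enc False S" if "finite S" for S
    using that by (rule seq_pow_clifford)
  have m: "minus_one \<otimes>\<^bsub>clifford I s\<^esub> enc False S = enc True S" if "finite S" for S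
    using that by (simp add: clifford_eq_iff[of "_ \<otimes>\<^bsub>clifford I s\<^esub> _"])
  have "is_generator (clifford I s) minus_one (\<lambda>i. enc False {i}) I"
    unfolding is_generator_def
  proof (intro conjI)
    show "basic_seq (clifford I s) minus_one (\<lambda>i. enc False {i}) I"
      by (auto simp: basic_seq_def * clifford_eq_iff[of "enc _ _"])
    show "carrier (clifford I s) =
      {seq_pow (clifford I s) (\<lambda>i. enc False {i}) S |S. finite S \<and> S \<subseteq> I} \<union>
      {minus_one \<otimes>\<^bsub>clifford I s\<^esub> seq_pow (clifford I s) (\<lambda>i. enc False {i}) S |S. finite S \<and> S \<subseteq> I}"
      unfolding carrier_clifford by (auto simp: * m)
  qed (auto simp: clifford_carrier)
  then show ?thesis
    by (auto simp: ac_generator_sig_def is_ac_generator_def clifford_eq_iff[of "_ \<otimes>\<^bsub>clifford I s\<^esub> _"]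
        symdiff_commute)
qed

section \<open>The homomorphism from the model\<close>

definition signed_elt :: "'a monoid \<Rightarrow> 'a \<Rightarrow> bool \<Rightarrow> 'a" where
  "signed_elt G m b = (if b then m else \<one>\<^bsub>G\<^esub>)"

definition clifford_map :: "'a monoid \<Rightarrow> 'a \<Rightarrow> (nat \<Rightarrow> 'a) \<Rightarrow> nat \<Rightarrow> 'a" where
  "clifford_map G m e x = signed_elt G m (neg x) \<otimes>\<^bsub>G\<^esub> seq_pow G e (supp x)"

text \<open>Only the relations are assumed, neither basicness nor generation. A candidate for a new
  generator therefore fits in before it is known to be one.\<close>

locale anticommuting = group G for G :: "'a monoid" (structure) +
  fixes m e and I :: "nat set" and s
  assumes m_closed [simp]: "m \<in> carrier G"
    and m_square: "m \<otimes> m = \<one>"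
    and m_central: "x \<in> carrier G \<Longrightarrow> m \<otimes> x = x \<otimes> m"
    and e_closed [simp]: "i \<in> I \<Longrightarrow> e i \<in> carrier G"
    and e_square: "i \<in> I \<Longrightarrow> e i \<otimes> e i = (if s i then m else \<one>)"
    and e_anti: "i \<in> I \<Longrightarrow> j \<in> I \<Longrightarrow> i \<noteq> j \<Longrightarrow> e i \<otimes> e j = m \<otimes> (e j \<otimes> e i)"
begin

abbreviation "sg \<equiv> signed_elt G m"
abbreviation "\<phi> \<equiv> clifford_map G m e"

lemma sg_closed [simp]: "sg b \<in> carrier G"
  by (simp add: signed_elt_def)

lemma sg_mult: "sg a \<otimes> sg b = sg (a \<noteq> b)"
  by (auto simp: signed_elt_def m_square)

lemma sg_assoc: "x \<in> carrier G \<Longrightarrow> sg a \<otimes> (sg b \<otimes> x) = sg (a \<noteq> b) \<otimes> x"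
  by (simp add: m_assoc[symmetric] sg_mult)

lemma sg_central: "x \<in> carrier G \<Longrightarrow> x \<otimes> sg b = sg b \<otimes> x"
  by (simp add: signed_elt_def m_central)

lemma sg_left_commute:
  "x \<in> carrier G \<Longrightarrow> y \<in> carrier G \<Longrightarrow> x \<otimes> (sg b \<otimes> y) = sg b \<otimes> (x \<otimes> y)"
  by (metis m_assoc sg_central sg_closed)

lemma seq_pow_closed [simp]:
  "finite S \<Longrightarrow> S \<subseteq> I \<Longrightarrow> seq_pow G e S \<in> carrier G"
  by (induction S rule: finite_linorder_min_induct) (auto simp: seq_pow_insert_min)

text \<open>Compare \<open>i\<close> with the least index \<open>b\<close>: below it,
  \<open>e i\<close> is simply prepended; at it, the two equal factors form a square; above it,
  \<open>e i\<close> passes \<open>e b\<close> at the price of one sign and the induction hypothesis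
  takes over.\<close>

lemma e_mult_seq_pow:
  assumes "finite T" "T \<subseteq> I" "i \<in> I"
  shows "e i \<otimes> seq_pow G e T = sg (tw s {i} T) \<otimes> seq_pow G e ({i} \<triangle> T)"
  using assms
proof (induction T rule: finite_linorder_min_induct)
  case empty
  then show ?case by (simp add: seq_pow_insert_min signed_elt_def)
next
  case (insert b A)
  have b: "b \<in> I" and A: "A \<subseteq> I" "finite A" "b \<notin> A" using insert by auto
  have bA: "insert b A = {b} \<triangle> A" using A by (intro insert_eq_symdiff) auto
  note pow = seq_pow_insert_min[OF \<open>finite A\<close> \<open>\<forall>a\<in>A. b < a\<close>]
  have pA: "seq_pow G e A \<in> carrier G" using A by simp
  consider "i < b" | "i = b" | "b < i" by linarith
  then show ?case
  proof cases
    case 1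
    then have less: "\<forall>j\<in>insert b A. i < j" using insert by auto
    then have "{i} \<triangle> insert b A = insert i (insert b A)" by (auto simp: symdiff_def)
    moreover have "tw s {i} (insert b A) = False" using less by (intro tw_less) auto
    ultimately show ?thesis
      using less A b insert.prems by (simp add: seq_pow_insert_min signed_elt_def)
  next
    case 2
    have "tw s {b} A = False" using insert by (intro tw_less) auto
    then have "tw s {i} (insert b A) = s b" using 2 insert
      by (simp add: bA tw_symdiff_right)
    moreover have "{i} \<triangle> insert b A = A" using 2 A by (auto simp: symdiff_def)
    ultimately show ?thesis using 2 pA b
      by (simp add: pow m_assoc[symmetric] e_square signed_elt_def)
  next
    case 3
    then have tw: "tw s {i} (insert b A) = (\<not> tw s {i} A)" using insert
      by (simp add: bA tw_symdiff_right)
    have less: "\<forall>j\<in>{i} \<triangle> A. b < j" using 3 insert by (auto simp: symdiff_def)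
    have sub: "{i} \<triangle> A \<subseteq> I" using A insert.prems by (intro symdiff_subset) auto
    have "{i} \<triangle> insert b A = insert b ({i} \<triangle> A)" using 3 A by (auto simp: symdiff_def)
    then have pow2: "seq_pow G e ({i} \<triangle> insert b A) = e b \<otimes> seq_pow G e ({i} \<triangle> A)"
      using less A by (simp add: seq_pow_insert_min)
    have "e i \<otimes> seq_pow G e (insert b A) = (e i \<otimes> e b) \<otimes> seq_pow G e A"
      using pA b insert.prems by (simp add: pow m_assoc)
    also have "\<dots> = sg True \<otimes> (e b \<otimes> (e i \<otimes> seq_pow G e A))"
      using e_anti[of i b] 3 pA b insert.prems by (simp add: m_assoc signed_elt_def)
    also have "e i \<otimes> seq_pow G e A = sg (tw s {i} A) \<otimes> seq_pow G e ({i} \<triangle> A)"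
      using insert A by simp
    also have "sg True \<otimes> (e b \<otimes> \<dots>) = sg (\<not> tw s {i} A) \<otimes> (e b \<otimes> seq_pow G e ({i} \<triangle> A))"
      using sub A b by (simp add: sg_left_commute[of "e b"] sg_assoc)
    finally show ?thesis using tw pow2 by simp
  qed
qed

lemma seq_pow_mult:
  assumes "finite S" "S \<subseteq> I" "finite T" "T \<subseteq> I"
  shows "seq_pow G e S \<otimes> seq_pow G e T = sg (tw s S T) \<otimes> seq_pow G e (S \<triangle> T)"
  using assms
proof (induction S rule: finite_linorder_min_induct)
  case empty
  then show ?case by (simp add: signed_elt_def)
next
  case (insert b A)
  have b: "b \<in> I" and A: "A \<subseteq> I" "finite A" "b \<notin> A" using insert by auto
  have bA: "insert b A = {b} \<triangle> A" using A by (intro insert_eq_symdiff) auto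
  note pow = seq_pow_insert_min[OF \<open>finite A\<close> \<open>\<forall>a\<in>A. b < a\<close>]
  have sub: "A \<triangle> T \<subseteq> I" "{b} \<triangle> (A \<triangle> T) \<subseteq> I"
    using A insert.prems b by (intro symdiff_subset; auto)+
  have tw: "tw s {b} A = False" using insert by (intro tw_less) auto
  have tw1: "tw s {b} (A \<triangle> T) = tw s {b} T"
    using A insert.prems by (simp add: tw_symdiff_right tw)
  have tw2: "tw s ({b} \<triangle> A) T = (tw s A T \<noteq> tw s {b} T)"
    using A insert.prems by (auto simp: tw_symdiff_left)
  have "seq_pow G e (insert b A) \<otimes> seq_pow G e T = e b \<otimes> (seq_pow G e A \<otimes> seq_pow G e T)"
    using A b insert.prems by (simp add: pow m_assoc)
  also have "\<dots> = sg (tw s A T) \<otimes> (e b \<otimes> seq_pow G e (A \<triangle> T))"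
    using insert A b sub by (simp add: sg_left_commute[of "e b"])
  also have "e b \<otimes> seq_pow G e (A \<triangle> T) = sg (tw s {b} (A \<triangle> T)) \<otimes> seq_pow G e ({b} \<triangle> (A \<triangle> T))"
    using A b sub insert.prems by (intro e_mult_seq_pow) auto
  also have "sg (tw s A T) \<otimes> \<dots> = sg (tw s (insert b A) T) \<otimes> seq_pow G e (insert b A \<triangle> T)"
    using A b sub insert.prems
    by (simp add: sg_assoc bA symdiff_assoc tw1 tw2)
  finally show ?case .
qed

lemma clifford_map_closed: "x \<in> carrier (clifford I s) \<Longrightarrow> \<phi> x \<in> carrier G"
  by (simp add: clifford_map_def clifford_carrier)

lemma clifford_map_mult:
  assumes "x \<in> carrier (clifford I s)" "y \<in> carrier (clifford I s)"
  shows "\<phi> (x \<otimes>\<^bsub>clifford I s\<^esub> y) = \<phi> x \<otimes> \<phi> y"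
proof -
  let ?p = "seq_pow G e"
  have c: "?p (supp x) \<in> carrier G" "?p (supp y) \<in> carrier G" "?p (supp x \<triangle> supp y) \<in> carrier G"
    using assms by (simp_all add: clifford_carrier symdiff_subset)
  have "\<phi> x \<otimes> \<phi> y = sg (neg x) \<otimes> (?p (supp x) \<otimes> (sg (neg y) \<otimes> ?p (supp y)))"
    using c by (simp add: clifford_map_def m_assoc)
  also have "\<dots> = sg (neg x) \<otimes> (sg (neg y) \<otimes> (?p (supp x) \<otimes> ?p (supp y)))"
    using c by (simp add: sg_left_commute[of "?p (supp x)"])
  also have "?p (supp x) \<otimes> ?p (supp y) = sg (tw s (supp x) (supp y)) \<otimes> ?p (supp x \<triangle> supp y)"
    using assms by (intro seq_pow_mult) (auto simp: clifford_carrier)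
  finally show ?thesis using c by (simp add: clifford_map_def sg_assoc)
qed

lemma clifford_map_simps:
  "\<phi> \<one>\<^bsub>clifford I s\<^esub> = \<one>" "\<phi> minus_one = m"
  "finite S \<Longrightarrow> S \<subseteq> I \<Longrightarrow> \<phi> (enc False S) = seq_pow G e S"
  "finite S \<Longrightarrow> S \<subseteq> I \<Longrightarrow> \<phi> (enc True S) = m \<otimes> seq_pow G e S"
  by (simp_all add: clifford_map_def signed_elt_def)

sublocale clifford_hom: group_hom "clifford I s" G "\<phi>"
  by (intro group_hom.intro group_hom_axioms.intro group_clifford is_group homI)
    (simp_all add: clifford_map_closed clifford_map_mult)

lemma image_clifford_map:
  "\<phi> ` carrier (clifford I s) =
    {seq_pow G e S |S. finite S \<and> S \<subseteq> I} \<union> {m \<otimes> seq_pow G e S |S. finite S \<and> S \<subseteq> I}"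
proof -
  have "\<phi> ` {enc b S |S. finite S \<and> S \<subseteq> I} = {\<phi> (enc b S) |S. finite S \<and> S \<subseteq> I}" for b
    by blast
  moreover have "{\<phi> (enc False S) |S. finite S \<and> S \<subseteq> I} = {seq_pow G e S |S. finite S \<and> S \<subseteq> I}"
    by (rule Collect_cong) (metis clifford_map_simps(3))
  moreover have "{\<phi> (enc True S) |S. finite S \<and> S \<subseteq> I} = {m \<otimes> seq_pow G e S |S. finite S \<and> S \<subseteq> I}"
    by (rule Collect_cong) (metis clifford_map_simps(4))
  ultimately show ?thesis
    by (simp only: carrier_clifford image_Un)
qed

text \<open>Recognises generators by bijectivity. A nontrivial product equal to 1 or -1 would have
  the same image as 1 or -1 of the model, against injectivity.\<close>

lemma ac_generator_sigI:
  assumes "inj_on \<phi> (carrier (clifford I s))" "carrier G \<subseteq> \<phi> ` carrier (clifford I s)"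
  shows "ac_generator_sig G m e I s"
proof -
  have "seq_pow G e S \<noteq> \<one> \<and> seq_pow G e S \<noteq> m" if "finite S" "S \<subseteq> I" "S \<noteq> {}" for S
  proof -
    have "enc False S \<in> carrier (clifford I s)" "minus_one \<in> carrier (clifford I s)"
      "\<one>\<^bsub>clifford I s\<^esub> \<in> carrier (clifford I s)"
      using that by (auto simp: clifford_carrier)
    moreover have "enc False S \<noteq> minus_one" "enc False S \<noteq> \<one>\<^bsub>clifford I s\<^esub>"
      using that by (auto simp: clifford_eq_iff[of "enc _ _"])
    ultimately have "\<phi> (enc False S) \<noteq> \<phi> minus_one" "\<phi> (enc False S) \<noteq> \<phi> \<one>\<^bsub>clifford I s\<^esub>"
      using inj_on_eq_iff[OF assms(1)] by blast+
    then show ?thesis using that by (simp add: clifford_map_simps)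
  qed
  then have "basic_seq G m e I" by (simp add: basic_seq_def)
  moreover have "carrier G = \<phi> ` carrier (clifford I s)"
    using assms(2) clifford_map_closed by blast
  ultimately have "is_generator G m e I"
    unfolding is_generator_def image_clifford_map[symmetric] using e_closed by blast
  then show ?thesis
    unfolding ac_generator_sig_def is_ac_generator_def using e_anti e_square by blast
qed

text \<open>An element of the kernel makes the product over its support equal to 1 or -1. Basicness
  empties the support, and then \<open>m \<noteq> \<one>\<close> rules out the negative
  sign.\<close>

lemma clifford_map_bij:
  assumes "is_generator G m e I" "m \<noteq> \<one>"
  shows "bij_betw \<phi> (carrier (clifford I s)) (carrier G)"
proof -
  note gen = assms(1)[unfolded is_generator_def image_clifford_map[symmetric]]
  have basic: "basic_seq G m e I" by (rule gen[THEN conjunct2, THEN conjunct1])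
  have "x = \<one>\<^bsub>clifford I s\<^esub>" if x: "x \<in> carrier (clifford I s)" "\<phi> x = \<one>" for x
  proof -
    have c: "supp x \<subseteq> I" using x(1) by (simp add: clifford_carrier)
    then have "seq_pow G e (supp x) = sg (neg x) \<otimes> \<phi> x"
      by (simp add: clifford_map_def sg_assoc) (simp add: signed_elt_def)
    then have eq: "seq_pow G e (supp x) = sg (neg x)" by (simp add: x(2))
    have supp: "supp x = {}"
    proof (rule ccontr)
      assume "supp x \<noteq> {}"
      then have "seq_pow G e (supp x) \<noteq> \<one>" "seq_pow G e (supp x) \<noteq> m"
        using basic c finite_supp unfolding basic_seq_def by blast+
      then show False unfolding eq signed_elt_def by presburger
    qed
    have "\<not> neg x"
    proof
      assume "neg x"
      then show False using eq assms(2) unfolding supp seq_pow_empty signed_elt_def by simp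
    qed
    then show ?thesis using supp by (intro neg_supp_eqI) simp_all
  qed
  then have "inj_on \<phi> (carrier (clifford I s))"
    by (simp add: clifford_hom.inj_on_one_iff)
  then show ?thesis
    using gen[THEN conjunct2, THEN conjunct2] unfolding bij_betw_def by blast
qed

text \<open>Over an infinite index set the signed group has centre \<open>{1, -1}\<close>: an even-length
  product anticommutes with its own factors, an odd-length one with all others.\<close>

lemma clifford_map_inj_infinite:
  assumes "infinite I" "m \<noteq> \<one>"
  shows "inj_on \<phi> (carrier (clifford I s))"
proof -
  let ?M = "clifford I s"
  have "x = \<one>\<^bsub>?M\<^esub>" if x: "x \<in> carrier ?M" "\<phi> x = \<one>" for x
  proof (cases "supp x = {}")
    case True
    then have "\<phi> x = sg (neg x)" by (simp add: clifford_map_def)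
    then have "neg x = False" using x assms by (auto simp: signed_elt_def)
    then show ?thesis using True by (auto simp: clifford_eq_iff[of x])
  next
    case False
    have c: "supp x \<subseteq> I" using x by (simp add: clifford_carrier)
    have "\<exists>i\<in>I. tw s (supp x) {i} \<noteq> tw s {i} (supp x)"
    proof (cases "even (card (supp x))")
      case True
      obtain i where i: "i \<in> supp x" using False by auto
      then have "supp x \<inter> {i} = {i}" by auto
      then have "tw s (supp x) {i} \<noteq> tw s {i} (supp x)"
        using True by (subst tw_swap) auto
      then show ?thesis using i c by auto
    next
      case odd: False
      obtain i where i: "i \<in> I" "i \<notin> supp x"
        using assms(1) by (meson finite_supp finite_subset subsetI)
      then have "tw s (supp x) {i} \<noteq> tw s {i} (supp x)"
        using odd by (subst tw_swap) auto
      then show ?thesis using i by auto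
    qed
    then obtain i where i: "i \<in> I" "tw s (supp x) {i} \<noteq> tw s {i} (supp x)" by auto
    define y where "y = enc False {i}"
    have y: "y \<in> carrier ?M" "minus_one \<in> carrier ?M" using i by (auto simp: y_def clifford_carrier)
    have "x \<otimes>\<^bsub>?M\<^esub> y = minus_one \<otimes>\<^bsub>?M\<^esub> (y \<otimes>\<^bsub>?M\<^esub> x)"
      using i by (auto simp: clifford_eq_iff[of "_ \<otimes>\<^bsub>?M\<^esub> _"] symdiff_commute y_def)
    \<comment> \<open>Since \<open>\<phi> x = \<one>\<close>, the anticommutation of
      \<open>x\<close> and \<open>y\<close> becomes
      \<open>\<phi> y = m \<otimes> \<phi> y\<close>.\<close>
    then have "\<phi> (x \<otimes>\<^bsub>?M\<^esub> y) = \<phi> (minus_one \<otimes>\<^bsub>?M\<^esub> (y \<otimes>\<^bsub>?M\<^esub> x))" by simp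
    then have "m = \<one>"
      using x y by (simp add: clifford_map_simps clifford_map_closed)
    then show ?thesis using assms by simp
  qed
  then show ?thesis
    by (auto simp: clifford_hom.inj_on_one_iff)
qed

end

section \<open>Signed groups as copies of the model, and changes of generator\<close>

lemma is_generator_closed: "is_generator G m e I \<Longrightarrow> i \<in> I \<Longrightarrow> e i \<in> carrier G"
  unfolding is_generator_def by (elim conjE) (rule bspec)

lemma ac_generator_sig_anticommuting:
  assumes "signed_group G m" "ac_generator_sig G m e I s"
  shows "anticommuting G m e I s" "is_generator G m e I" "m \<noteq> \<one>\<^bsub>G\<^esub>"
proof -
  have G: "group G" "m \<in> carrier G" "m \<otimes>\<^bsub>G\<^esub> m = \<one>\<^bsub>G\<^esub>"
    "\<forall>x\<in>carrier G. m \<otimes>\<^bsub>G\<^esub> x = x \<otimes>\<^bsub>G\<^esub> m" "m \<noteq> \<one>\<^bsub>G\<^esub>"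
    using assms(1) unfolding signed_group_def by blast+
  have ac: "is_generator G m e I"
    "\<forall>i\<in>I. \<forall>j\<in>I. i \<noteq> j \<longrightarrow> e i \<otimes>\<^bsub>G\<^esub> e j = m \<otimes>\<^bsub>G\<^esub> (e j \<otimes>\<^bsub>G\<^esub> e i)"
    "\<forall>i\<in>I. e i \<otimes>\<^bsub>G\<^esub> e i = (if s i then m else \<one>\<^bsub>G\<^esub>)"
    using assms(2) unfolding ac_generator_sig_def is_ac_generator_def by blast+
  have e: "\<forall>i\<in>I. e i \<in> carrier G" using ac(1) by (simp add: is_generator_closed)
  show "is_generator G m e I" "m \<noteq> \<one>\<^bsub>G\<^esub>" by fact+
  interpret group G by fact
  show "anticommuting G m e I s"
    using G ac e by unfold_locales blast+
qed

lemma signed_iso_clifford: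
  assumes "signed_group G m" "ac_generator_sig G m e I s"
  shows "signed_iso G m (clifford I s) minus_one"
proof -
  interpret anticommuting G m e I s
    using assms by (rule ac_generator_sig_anticommuting)
  have bij: "bij_betw \<phi> (carrier (clifford I s)) (carrier G)"
    using ac_generator_sig_anticommuting[OF assms] by (intro clifford_map_bij)
  have iso: "\<phi> \<in> iso (clifford I s) G"
    using clifford_hom.homh bij by (rule isoI)
  have "inv_into (carrier (clifford I s)) \<phi> m = minus_one"
    using bij_betw_imp_inj_on[OF bij]
    by (metis inv_into_f_f clifford_map_simps(2) clifford_carrier minus_one_simps(1) empty_subsetI)
  then show ?thesis
    unfolding signed_iso_def using group.iso_set_sym[OF group_clifford iso] by blast
qed

text \<open>No independence of the sets \<open>A i\<close> has to be assumed: the new sequence is basic by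
  counting if \<open>I\<close> is finite, and because the centre is trivial if \<open>I\<close> is infinite.\<close>

lemma ac_generator_sig_change:
  assumes sg: "signed_group G m" and ac: "ac_generator_sig G m e I s"
    and A: "\<And>i. i \<in> I \<Longrightarrow> finite (A i) \<and> A i \<subseteq> I"
    and anti: "\<And>i j. i \<in> I \<Longrightarrow> j \<in> I \<Longrightarrow> i \<noteq> j \<Longrightarrow> odd (card (A i) * card (A j) + card (A i \<inter> A j))"
    and span: "\<And>D i. i \<in> I \<Longrightarrow> (\<And>j. j \<in> I \<Longrightarrow> A j \<in> D) \<Longrightarrow>
      (\<And>S T. S \<in> D \<Longrightarrow> T \<in> D \<Longrightarrow> S \<triangle> T \<in> D) \<Longrightarrow> {i} \<in> D"
  shows "ac_generator_sig G m (\<lambda>i. seq_pow G e (A i)) I (\<lambda>i. tw s (A i) (A i))"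
proof -
  note ac' = ac_generator_sig_anticommuting[OF sg ac]
  interpret E: anticommuting G m e I s by fact
  let ?e = "\<lambda>i. seq_pow G e (A i)" and ?s = "\<lambda>i. tw s (A i) (A i)"
  have mult: "?e i \<otimes>\<^bsub>G\<^esub> ?e j = E.sg (tw s (A i) (A j)) \<otimes>\<^bsub>G\<^esub> seq_pow G e (A i \<triangle> A j)"
    if "i \<in> I" "j \<in> I" for i j
    using A that by (intro E.seq_pow_mult) auto
  have c: "seq_pow G e (A i \<triangle> A j) \<in> carrier G" if "i \<in> I" "j \<in> I" for i j
    using A that by (simp add: symdiff_subset)
  interpret F: anticommuting G m ?e I ?s
  proof
    fix i assume "i \<in> I"
    then show "?e i \<in> carrier G" "?e i \<otimes>\<^bsub>G\<^esub> ?e i = (if ?s i then m else \<one>\<^bsub>G\<^esub>)"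
      using A by (auto simp: mult signed_elt_def)
  next
    fix i j assume ij: "i \<in> I" "j \<in> I" "i \<noteq> j"
    have "tw s (A i) (A j) = (\<not> tw s (A j) (A i))"
      using anti[OF ij] tw_swap[of "A i" "A j" s] A ij by blast
    then have "m \<otimes>\<^bsub>G\<^esub> (?e j \<otimes>\<^bsub>G\<^esub> ?e i) = E.sg True \<otimes>\<^bsub>G\<^esub> (E.sg (\<not> tw s (A i) (A j)) \<otimes>\<^bsub>G\<^esub> seq_pow G e (A i \<triangle> A j))"
      unfolding mult[OF ij(2,1)] symdiff_commute[of "A j" "A i"] by (simp add: signed_elt_def)
    also have "\<dots> = ?e i \<otimes>\<^bsub>G\<^esub> ?e j"
      unfolding mult[OF ij(1,2)] E.sg_assoc[OF c[OF ij(1,2)]] by simp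
    finally show "?e i \<otimes>\<^bsub>G\<^esub> ?e j = m \<otimes>\<^bsub>G\<^esub> (?e j \<otimes>\<^bsub>G\<^esub> ?e i)" by (rule sym)
  qed (rule E.m_closed E.m_square E.m_central; assumption?)+
  let ?R = "F.\<phi> ` carrier (clifford I ?s)"
  have R_mult: "x \<otimes>\<^bsub>G\<^esub> y \<in> ?R" if "x \<in> ?R" "y \<in> ?R" for x y
  proof -
    obtain a b where ab: "a \<in> carrier (clifford I ?s)" "b \<in> carrier (clifford I ?s)" "x = F.\<phi> a" "y = F.\<phi> b"
      using \<open>x \<in> ?R\<close> \<open>y \<in> ?R\<close> by blast
    then have "x \<otimes>\<^bsub>G\<^esub> y = F.\<phi> (a \<otimes>\<^bsub>clifford I ?s\<^esub> b)" by (simp only: F.clifford_map_mult)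
    moreover have "a \<otimes>\<^bsub>clifford I ?s\<^esub> b \<in> carrier (clifford I ?s)"
      using ab by (intro F.clifford_hom.G.m_closed)
    ultimately show ?thesis by (rule image_eqI)
  qed
  have R_sg: "E.sg b \<in> ?R" for b
  proof -
    have "F.\<phi> (enc b {}) = E.sg b" by (simp add: clifford_map_def)
    moreover have "enc b {} \<in> carrier (clifford I ?s)" by (simp add: clifford_carrier)
    ultimately show ?thesis by (metis imageI)
  qed
  \<comment> \<open>The supports whose products lie in the image of the new sequence form a family
    closed under symmetric difference, as \<open>span\<close> requires. Signs do not matter because
    the image contains \<open>m\<close>.\<close>
  define D where "D = {S. finite S \<and> S \<subseteq> I \<and> seq_pow G e S \<in> ?R}"
  have "{i} \<in> D" if "i \<in> I" for i
    using that
  proof (rule span)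
    fix j assume j: "j \<in> I"
    have "seq_pow G ?e {j} = ?e j"
      using j A by (simp add: seq_pow_insert_min)
    then have "?e j = F.\<phi> (enc False {j})"
      using j A by (simp add: clifford_map_def signed_elt_def)
    moreover have "enc False {j} \<in> carrier (clifford I ?s)" using j by (simp add: clifford_carrier)
    ultimately have "?e j \<in> ?R" by (rule image_eqI)
    then show "A j \<in> D" using A[OF j] unfolding D_def by blast
  next
    fix S T assume ST: "S \<in> D" "T \<in> D"
    then have fin: "finite S" "S \<subseteq> I" "finite T" "T \<subseteq> I"
      and R: "seq_pow G e S \<in> ?R" "seq_pow G e T \<in> ?R"
      unfolding D_def by blast+
    have sub: "S \<triangle> T \<subseteq> I" using fin by (simp add: symdiff_subset)
    have "seq_pow G e (S \<triangle> T) = E.sg (tw s S T) \<otimes>\<^bsub>G\<^esub> (seq_pow G e S \<otimes>\<^bsub>G\<^esub> seq_pow G e T)"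
      using fin sub by (simp add: E.seq_pow_mult E.sg_assoc) (simp add: signed_elt_def)
    also have "\<dots> \<in> ?R" by (intro R_mult R_sg R)
    finally show "S \<triangle> T \<in> D" using fin sub by (simp add: D_def)
  qed
  then have e_R: "e i \<in> ?R" if "i \<in> I" for i
  proof -
    have "seq_pow G e {i} \<in> ?R" using \<open>\<And>i. i \<in> I \<Longrightarrow> {i} \<in> D\<close>[OF that] unfolding D_def by blast
    then show ?thesis using that by (simp add: seq_pow_insert_min)
  qed
  have pow_R: "seq_pow G e S \<in> ?R" if "finite S" "S \<subseteq> I" for S
    using that
  proof (induction S rule: finite_linorder_min_induct)
    case empty
    then show ?case using R_sg[of False] by (simp add: signed_elt_def)
  next
    case (insert b A)
    then have "seq_pow G e (insert b A) = e b \<otimes>\<^bsub>G\<^esub> seq_pow G e A" by (simp add: seq_pow_insert_min)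
    also have "\<dots> \<in> ?R" using insert by (intro R_mult e_R) auto
    finally show ?case .
  qed
  have bij: "bij_betw E.\<phi> (carrier (clifford I s)) (carrier G)"
    using ac' by (intro E.clifford_map_bij)
  have sub: "carrier G \<subseteq> ?R"
  proof
    fix x assume "x \<in> carrier G"
    then obtain y where y: "y \<in> carrier (clifford I s)" "x = E.\<phi> y"
      using bij by (auto simp: bij_betw_def)
    then have "x = E.sg (neg y) \<otimes>\<^bsub>G\<^esub> seq_pow G e (supp y)" "supp y \<subseteq> I"
      by (simp_all add: clifford_map_def clifford_carrier)
    then show "x \<in> ?R" by (simp only:) (intro R_mult R_sg pow_R finite_supp)
  qed
  then have eq: "?R = carrier G" using F.clifford_map_closed by blast
  have "inj_on F.\<phi> (carrier (clifford I ?s))"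
  proof (cases "finite I")
    case True
    \<comment> \<open>Models with different signatures have the same carrier, so for finite
      \<open>I\<close> the new map is a surjection between finite sets of equal size.\<close>
    have "carrier (clifford I ?s) = carrier (clifford I s)" by (simp add: clifford_def)
    moreover have "finite (carrier (clifford I s))"
      using True by (simp add: carrier_clifford)
    moreover have "card ?R = card (carrier (clifford I s))"
      unfolding eq using bij_betw_same_card[OF bij] by simp
    ultimately show ?thesis by (intro eq_card_imp_inj_on) simp_all
  next
    case False
    then show ?thesis using ac' by (intro F.clifford_map_inj_infinite)
  qed
  then show ?thesis using sub by (rule F.ac_generator_sigI)
qed

lemma ac_generator_sig_cong:
  assumes "ac_generator_sig G m e I s" "\<And>i. i \<in> I \<Longrightarrow> s i = t i"
  shows "ac_generator_sig G m e I t"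
  using assms unfolding ac_generator_sig_def by simp

text \<open>The order of the terms is immaterial. One bijection for each signature is required,
  instead of equal counts, so that the lemma also serves infinite index sets.\<close>

lemma ac_generator_sig_permute:
  assumes sg: "signed_group G m" and ac: "ac_generator_sig G m e I s"
    and f: "bij_betw f {i \<in> I. t i} {i \<in> I. s i}"
    and g: "bij_betw g {i \<in> I. \<not> t i} {i \<in> I. \<not> s i}"
  shows "\<exists>e. ac_generator_sig G m e I t"
proof -
  define p where "p i = (if t i then f i else g i)" for i
  have "bij_betw p {i \<in> I. t i} {i \<in> I. s i}" "bij_betw p {i \<in> I. \<not> t i} {i \<in> I. \<not> s i}"
    by (rule bij_betw_cong[THEN iffD1, OF _ f], simp add: p_def)
      (rule bij_betw_cong[THEN iffD1, OF _ g], simp add: p_def)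
  then have "bij_betw p ({i \<in> I. t i} \<union> {i \<in> I. \<not> t i}) ({i \<in> I. s i} \<union> {i \<in> I. \<not> s i})"
    by (rule bij_betw_combine) auto
  moreover have "{i \<in> I. u i} \<union> {i \<in> I. \<not> u i} = I" for u by auto
  ultimately have p: "bij_betw p I I" by simp
  have st: "s (p i) = t i" if "i \<in> I" for i
    using bij_betwE[OF f] bij_betwE[OF g] that by (cases "t i") (simp_all add: p_def)
  have p_in: "p i \<in> I" if "i \<in> I" for i
    using bij_betwE[OF p] that by blast
  have "ac_generator_sig G m (\<lambda>i. seq_pow G e {p i}) I (\<lambda>i. tw s {p i} {p i})"
    using sg ac
  proof (rule ac_generator_sig_change)
    fix i j assume "i \<in> I" "j \<in> I" "i \<noteq> j"
    then have "p i \<noteq> p j" using inj_on_eq_iff[OF bij_betw_imp_inj_on[OF p]] by blast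
    then show "odd (card {p i} * card {p j} + card ({p i} \<inter> {p j}))" by simp
  next
    fix D i assume i: "i \<in> I" and D: "\<And>j. j \<in> I \<Longrightarrow> {p j} \<in> D"
    have "i \<in> p ` I" using i bij_betw_imp_surj_on[OF p] by (simp only:)
    then obtain j where j: "i = p j" "j \<in> I" by (rule imageE)
    show "{i} \<in> D" unfolding j(1) by (rule D[OF j(2)])
  qed (simp add: p_in)
  then have "ac_generator_sig G m (\<lambda>i. seq_pow G e {p i}) I t"
  proof (rule ac_generator_sig_cong)
    show "tw s {p i} {p i} = t i" if "i \<in> I" for i
      unfolding tw_singleton st[OF that] by simp
  qed
  then show ?thesis by blast
qed

lemma ac_generator_sig_permute_finite:
  assumes "signed_group G m" "ac_generator_sig G m e {..<n} s"
    and card: "card {i \<in> {..<n}. s i} = card {i \<in> {..<n}. t i}"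
  shows "\<exists>e. ac_generator_sig G m e {..<n} t"
proof -
  have compl: "card {i \<in> {..<n}. \<not> u i} = n - card {i \<in> {..<n}. u i}" for u
  proof -
    have "{i \<in> {..<n}. \<not> u i} = {..<n} - {i \<in> {..<n}. u i}" by blast
    then show ?thesis by (simp only:) (subst card_Diff_subset; auto)
  qed
  have fin: "finite {i \<in> {..<n}. u i}" for u by simp
  have card': "card {i \<in> {..<n}. \<not> t i} = card {i \<in> {..<n}. \<not> s i}"
    unfolding compl card ..
  obtain f where "bij_betw f {i \<in> {..<n}. t i} {i \<in> {..<n}. s i}"
    using finite_same_card_bij[OF fin fin card[symmetric]] by blast
  moreover obtain g where "bij_betw g {i \<in> {..<n}. \<not> t i} {i \<in> {..<n}. \<not> s i}"
    using finite_same_card_bij[OF fin fin card'] by blast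
  ultimately show ?thesis by (rule ac_generator_sig_permute[OF assms(1,2)])
qed

text \<open>Multiply all other terms by a term of square 1.\<close>

lemma ac_generator_sig_reflect:
  assumes sg: "signed_group G m" and ac: "ac_generator_sig G m e {..<n} (\<lambda>i. i < q)" and q: "q < n"
  shows "\<exists>e. ac_generator_sig G m e {..<n} (\<lambda>i. i < n - 1 - q)"
proof -
  let ?s = "\<lambda>i. i < q"
  \<comment> \<open>Negative terms come first, so \<open>q < n\<close> makes the last term one of
    square 1.\<close>
  define A where "A i = (if i = n - 1 then {n - 1} else {i, n - 1})" for i
  have *: "ac_generator_sig G m (\<lambda>i. seq_pow G e (A i)) {..<n} (\<lambda>i. tw ?s (A i) (A i))"
    using sg ac
  proof (rule ac_generator_sig_change)
    fix i j assume "i \<in> {..<n}" "j \<in> {..<n}" "i \<noteq> j"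
    then show "odd (card (A i) * card (A j) + card (A i \<inter> A j))"
      by (simp add: A_def)
  next
    fix D i assume i: "i \<in> {..<n}" and A: "\<And>j. j \<in> {..<n} \<Longrightarrow> A j \<in> D"
      and D: "\<And>S T. S \<in> D \<Longrightarrow> T \<in> D \<Longrightarrow> S \<triangle> T \<in> D"
    have "A i \<triangle> A (n - 1) \<in> D" "A (n - 1) \<in> D" using i q by (auto intro!: A D)
    moreover have "A i \<triangle> A (n - 1) = {i}" if "i \<noteq> n - 1"
      using that by (auto simp: A_def symdiff_def)
    ultimately show "{i} \<in> D" by (cases "i = n - 1") (auto simp: A_def)
  qed (use q in \<open>auto simp: A_def\<close>)
  \<comment> \<open>Multiplication by an anticommuting term of square 1 negates the square, because
    of the single swap. Only the last term keeps its own square.\<close>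
  have "tw ?s (A i) (A i) \<longleftrightarrow> q \<le> i \<and> i \<noteq> n - 1" for i
  proof (cases "i = n - 1")
    case True
    then show ?thesis using q by (simp add: A_def)
  next
    case False
    have "tw ?s (insert i {n - 1}) (insert i {n - 1}) \<longleftrightarrow> \<not> i < q"
      using False q by (subst tw_insert_self) auto
    then show ?thesis using False by (simp add: A_def not_less)
  qed
  then have "x \<in> {i \<in> {..<n}. tw ?s (A i) (A i)} \<longleftrightarrow> x \<in> {q..<n - 1}" for x
    by (simp only: mem_Collect_eq lessThan_iff atLeastLessThan_iff) linarith
  then have "{i \<in> {..<n}. tw ?s (A i) (A i)} = {q..<n - 1}" by blast
  moreover have "{i \<in> {..<n}. i < n - 1 - q} = {..<n - 1 - q}" by auto
  ultimately have "card {i \<in> {..<n}. tw ?s (A i) (A i)} = card {i \<in> {..<n}. i < n - 1 - q}" by simp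
  then show ?thesis by (rule ac_generator_sig_permute_finite[OF sg *])
qed

text \<open>In a block of four terms of equal square, multiplying each by the product of the
  block, i.e. passing to the complementary triples, flips the four squares and affects
  nothing else. Hence it can be done in infinitely many blocks at once.\<close>

lemma ac_generator_sig_flip_blocks:
  assumes sg: "signed_group G m" and ac: "ac_generator_sig G m e I s"
    and J: "\<And>k. k \<in> J \<Longrightarrow> {4 * k..<4 * k + 4} \<subseteq> I"
    and const: "\<And>i. i div 4 \<in> J \<Longrightarrow> s i = s (4 * (i div 4))"
  shows "\<exists>e. ac_generator_sig G m e I (\<lambda>i. s i \<noteq> (i div 4 \<in> J))"
proof -
  define B where "B i = {4 * (i div 4)..<4 * (i div 4) + 4}" for i :: nat
  have B_iff: "j \<in> B i \<longleftrightarrow> j div 4 = i div 4" for i j unfolding B_def by auto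
  have card_B: "card (B i) = 4" and fin_B: "finite (B i)" for i by (simp_all add: B_def)
  define A where "A i = (if i div 4 \<in> J then B i - {i} else {i})" for i
  have card_A: "card (A i) = (if i div 4 \<in> J then 3 else 1)" for i
    by (simp add: A_def card_B fin_B B_iff)
  have B_I: "B i \<subseteq> I" if "i div 4 \<in> J" for i using J[OF that] by (simp add: B_def)
  have triple: "\<exists>a b c. B i - {i} = {a, b, c} \<and> a \<noteq> b \<and> b \<noteq> c \<and> a \<noteq> c" for i
  proof -
    have "card (B i - {i}) = 3" by (simp add: card_B fin_B B_iff)
    then show ?thesis by (simp add: card_3_iff)
  qed
  \<comment> \<open>A product of three anticommuting terms of equal square has three equal signs
    from the squares and three swaps, in total the opposite sign.\<close>
  have tw: "tw s (A i) (A i) \<longleftrightarrow> (s i \<noteq> (i div 4 \<in> J))" for i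
  proof (cases "i div 4 \<in> J")
    case True
    obtain a b c where abc: "B i - {i} = {a, b, c}" "a \<noteq> b" "b \<noteq> c" "a \<noteq> c" using triple by blast
    then have "a \<in> B i" "b \<in> B i" "c \<in> B i" by auto
    then have "s a = s i" "s b = s i" "s c = s i"
      using True by (metis B_iff const)+
    then show ?thesis using True abc by (simp add: A_def tw_insert_self)
  next
    case False
    then show ?thesis by (simp add: A_def)
  qed
  have "ac_generator_sig G m (\<lambda>i. seq_pow G e (A i)) I (\<lambda>i. tw s (A i) (A i))"
    using sg ac
  proof (rule ac_generator_sig_change)
    show "finite (A i) \<and> A i \<subseteq> I" if "i \<in> I" for i
      using that B_I[of i] by (auto simp: A_def fin_B)
  next
    fix i j assume "i \<in> I" "j \<in> I" "i \<noteq> j"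
    show "odd (card (A i) * card (A j) + card (A i \<inter> A j))"
    proof (cases "i div 4 = j div 4 \<and> i div 4 \<in> J")
      case True
      then have "B j = B i" by (simp add: B_def)
      then have "A i \<inter> A j = B i - {i, j}" using True by (auto simp: A_def)
      moreover have "card (B i - {i, j}) = 2"
        using True \<open>i \<noteq> j\<close> by (simp add: card_Diff_subset card_B fin_B B_iff)
      ultimately show ?thesis using True by (simp add: card_A)
    next
      \<comment> \<open>Here the sets are disjoint, and each has 1 or 3 elements, so the product of
        their sizes is odd.\<close>
      case False
      then have "A i \<inter> A j = {}" using \<open>i \<noteq> j\<close> by (auto simp: A_def B_iff split: if_splits)
      then show ?thesis by (simp add: card_A)
    qed
  next
    fix D i assume i: "i \<in> I" and A: "\<And>j. j \<in> I \<Longrightarrow> A j \<in> D"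
      and D: "\<And>S T. S \<in> D \<Longrightarrow> T \<in> D \<Longrightarrow> S \<triangle> T \<in> D"
    show "{i} \<in> D"
    proof (cases "i div 4 \<in> J")
      case True
      obtain a b c where abc: "B i - {i} = {a, b, c}" "a \<noteq> b" "b \<noteq> c" "a \<noteq> c" using triple by blast
      have i_B: "i \<in> B i" by (simp add: B_iff)
      have mem: "a \<in> B i" "b \<in> B i" "c \<in> B i" using abc by auto
      have A_eq: "A j = B i - {j} \<and> j \<in> I" if "j \<in> B i" for j
      proof -
        have "j div 4 = i div 4" using that by (simp add: B_iff)
        then show ?thesis using True B_I[OF True] that by (auto simp: A_def B_def)
      qed
      \<comment> \<open>The index \<open>i\<close> lies in all three triples, while each of
        \<open>a\<close>, \<open>b\<close>, \<open>c\<close> lies in exactly two of them and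
        cancels.\<close>
      have "(A a \<triangle> A b) \<triangle> A c \<in> D" using mem A_eq by (intro A D) auto
      moreover have "(A a \<triangle> A b) \<triangle> A c = {i}"
      proof -
        have "B i = {i, a, b, c}" using abc i_B by auto
        moreover have "i \<notin> {a, b, c}" using abc by auto
        ultimately show ?thesis using abc(2-4) A_eq mem by (auto simp: symdiff_def)
      qed
      ultimately show ?thesis by simp
    next
      case False
      then show ?thesis using A[OF i] by (simp add: A_def)
    qed
  qed
  then show ?thesis unfolding tw by blast
qed

text \<open>Block 0 consists of the indices 0 to 3, all of them negative because
  \<open>4 \<le> q\<close>. After the flip the negative terms are \<open>{4..<q}\<close>, and a
  permutation moves them to the front.\<close>

lemma ac_generator_sig_minus4:
  assumes sg: "signed_group G m" and ac: "ac_generator_sig G m e {..<n} (\<lambda>i. i < q)"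
    and q: "4 \<le> q" "q \<le> n"
  shows "\<exists>e. ac_generator_sig G m e {..<n} (\<lambda>i. i < q - 4)"
proof -
  have "\<exists>e. ac_generator_sig G m e {..<n} (\<lambda>i. (i < q) \<noteq> (i div 4 \<in> {0}))"
  proof (rule ac_generator_sig_flip_blocks[OF sg ac])
    show "{4 * k..<4 * k + 4} \<subseteq> {..<n}" if "k \<in> {0}" for k
      using that q by auto
    show "(i < q) = (4 * (i div 4) < q)" if "i div 4 \<in> {0}" for i
      using that q by auto
  qed
  then obtain e' where e': "ac_generator_sig G m e' {..<n} (\<lambda>i. (i < q) \<noteq> (i div 4 \<in> {0}))"
    by (rule exE)
  have "i div 4 \<in> {0} \<longleftrightarrow> i < 4" for i :: nat by (simp add: div_eq_0_iff)
  then have "x \<in> {i \<in> {..<n}. (i < q) \<noteq> (i div 4 \<in> {0})} \<longleftrightarrow> x \<in> {4..<q}" for x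
    using q by (simp only: mem_Collect_eq lessThan_iff atLeastLessThan_iff) linarith
  then have "{i \<in> {..<n}. (i < q) \<noteq> (i div 4 \<in> {0})} = {4..<q}" by blast
  moreover have "{i \<in> {..<n}. i < q - 4} = {..<q - 4}" using q by auto
  ultimately have "card {i \<in> {..<n}. (i < q) \<noteq> (i div 4 \<in> {0})} = card {i \<in> {..<n}. i < q - 4}"
    by simp
  then show ?thesis by (rule ac_generator_sig_permute_finite[OF sg e'])
qed

section \<open>Normal form for the number of negative terms\<close>

lemma has_ac_generator_sig:
  assumes "signed_group G m" "has_ac_generator G m I"
  obtains e s where "ac_generator_sig G m e I s"
proof -
  obtain e where e: "is_ac_generator G m e I" using assms(2) unfolding has_ac_generator_def by blast
  then have "is_generator G m e I" unfolding is_ac_generator_def by blast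
  then have c: "\<forall>i\<in>I. e i \<in> carrier G" by (simp add: is_generator_closed)
  have "\<forall>x\<in>carrier G. x \<otimes>\<^bsub>G\<^esub> x = \<one>\<^bsub>G\<^esub> \<or> x \<otimes>\<^bsub>G\<^esub> x = m"
    using assms(1) unfolding signed_group_def by blast
  then have "ac_generator_sig G m e I (\<lambda>i. e i \<otimes>\<^bsub>G\<^esub> e i = m)"
    using c e unfolding ac_generator_sig_def by auto
  then show thesis by (rule that)
qed

lemma has_ac_generator_count:
  assumes "signed_group G m" "has_ac_generator G m {..<n}"
  shows "\<exists>q\<le>n. \<exists>e. ac_generator_sig G m e {..<n} (\<lambda>i. i < q)"
proof -
  obtain e s where e: "ac_generator_sig G m e {..<n} s"
    using has_ac_generator_sig[OF assms] by blast
  let ?q = "card {i \<in> {..<n}. s i}"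
  have q: "?q \<le> n" using card_mono[of "{..<n}" "{i \<in> {..<n}. s i}"] by auto
  then have "{i \<in> {..<n}. i < ?q} = {..<?q}" by auto
  then have "?q = card {i \<in> {..<n}. i < ?q}" by simp
  from ac_generator_sig_permute_finite[OF assms(1) e this] q show ?thesis by blast
qed

lemma ac_generator_sig_normal_form:
  assumes sg: "signed_group G m" and gen: "has_ac_generator G m {..<n}" and n: "2 \<le> n"
  obtains q e where "ac_generator_sig G m e {..<n} (\<lambda>i. i < q)" "n div 2 \<le> q" "q \<le> n - n div 2 + 1"
proof -
  let ?k = "n div 2"
  let ?P = "\<lambda>q. \<exists>e. ac_generator_sig G m e {..<n} (\<lambda>i. i < q)"
  \<comment> \<open>The slack of 2 makes descent by steps of 4 safe: from above the window,
    \<open>q - 4\<close> is still at least \<open>?k - 2\<close>, and the two values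
    \<open>?k - 2\<close> and \<open>?k - 1\<close> below the window are reflected into it.\<close>
  have *: "\<exists>q. ?P q \<and> ?k \<le> q \<and> q \<le> n - ?k + 1" if "?P q" "q \<le> n" "?k \<le> q + 2" for q
    using that
  proof (induction q rule: less_induct)
    case (less q)
    then obtain e where e: "ac_generator_sig G m e {..<n} (\<lambda>i. i < q)" by blast
    consider "q < ?k" | "?k \<le> q" "q \<le> n - ?k + 1" | "n - ?k + 1 < q" by linarith
    then show ?case
    proof cases
      case 1
      then have "?P (n - 1 - q)" by (intro ac_generator_sig_reflect[OF sg e]) simp
      moreover have "?k \<le> n - 1 - q" "n - 1 - q \<le> n - ?k + 1" using 1 less.prems(3) by linarith+
      ultimately show ?thesis by blast
    next
      case 2
      then show ?thesis using less.prems(1) by blast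
    next
      case 3
      then have q: "4 \<le> q" using less.prems(2) by linarith
      then have "?P (q - 4)" using less.prems(2) by (intro ac_generator_sig_minus4[OF sg e])
      moreover have "q - 4 < q" "q - 4 \<le> n" "?k \<le> q - 4 + 2"
        using q 3 less.prems(2) by linarith+
      ultimately show ?thesis by (intro less.IH)
    qed
  qed
  obtain q e where q: "q \<le> n" and e: "ac_generator_sig G m e {..<n} (\<lambda>i. i < q)"
    using has_ac_generator_count[OF sg gen] by blast
  have "\<exists>q. ?P q \<and> ?k \<le> q \<and> q \<le> n - ?k + 1"
  proof (cases "?k \<le> q")
    case True
    then show ?thesis using e q by (intro *[of q]) auto
  next
    \<comment> \<open>Smaller values of \<open>q\<close> are too low for the descent; one reflection
      first lifts them to at least \<open>?k\<close>.\<close>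
    case False
    then have "?P (n - 1 - q)" by (intro ac_generator_sig_reflect[OF sg e]) simp
    moreover have "n - 1 - q \<le> n" "?k \<le> n - 1 - q + 2" using False by linarith+
    ultimately show ?thesis by (rule *)
  qed
  then show thesis using that by blast
qed

section \<open>Counting elements of square 1\<close>

lemma signed_iso_card_involutions:
  assumes "signed_iso G m H m'" "group G" "group H"
  shows "card {x \<in> carrier G. x \<otimes>\<^bsub>G\<^esub> x = \<one>\<^bsub>G\<^esub>} = card {x \<in> carrier H. x \<otimes>\<^bsub>H\<^esub> x = \<one>\<^bsub>H\<^esub>}"
proof -
  obtain h where h: "h \<in> hom G H" "bij_betw h (carrier G) (carrier H)"
    using assms(1) unfolding signed_iso_def iso_def by blast
  have sq: "h x \<otimes>\<^bsub>H\<^esub> h x = \<one>\<^bsub>H\<^esub> \<longleftrightarrow> x \<otimes>\<^bsub>G\<^esub> x = \<one>\<^bsub>G\<^esub>" if "x \<in> carrier G" for x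
  proof -
    have "h x \<otimes>\<^bsub>H\<^esub> h x = h (x \<otimes>\<^bsub>G\<^esub> x)" using hom_mult[OF h(1) that that] by (rule sym)
    moreover have "\<one>\<^bsub>H\<^esub> = h \<one>\<^bsub>G\<^esub>" using hom_one[OF h(1) assms(2,3)] by (rule sym)
    moreover have "x \<otimes>\<^bsub>G\<^esub> x \<in> carrier G" "\<one>\<^bsub>G\<^esub> \<in> carrier G"
      using assms(2) that by (simp_all add: group.is_monoid monoid.m_closed)
    ultimately show ?thesis
      using inj_on_eq_iff[OF bij_betw_imp_inj_on[OF h(2)]] by (simp only:)
  qed
  have "h ` {x \<in> carrier G. x \<otimes>\<^bsub>G\<^esub> x = \<one>\<^bsub>G\<^esub>} = {y \<in> h ` carrier G. y \<otimes>\<^bsub>H\<^esub> y = \<one>\<^bsub>H\<^esub>}"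
    using sq by (intro Set.set_eqI) (force simp: image_iff)
  then have eq: "h ` {x \<in> carrier G. x \<otimes>\<^bsub>G\<^esub> x = \<one>\<^bsub>G\<^esub>} = {y \<in> carrier H. y \<otimes>\<^bsub>H\<^esub> y = \<one>\<^bsub>H\<^esub>}"
    by (simp only: bij_betw_imp_surj_on[OF h(2)])
  have "inj_on h {x \<in> carrier G. x \<otimes>\<^bsub>G\<^esub> x = \<one>\<^bsub>G\<^esub>}"
    using bij_betw_imp_inj_on[OF h(2)] by (rule inj_on_subset) blast
  from card_image[OF this] show ?thesis unfolding eq by (rule sym)
qed

lemma clifford_square_one:
  "x \<otimes>\<^bsub>clifford I s\<^esub> x = \<one>\<^bsub>clifford I s\<^esub> \<longleftrightarrow> \<not> tw s (supp x) (supp x)"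
  by (auto simp: clifford_eq_iff[of "x \<otimes>\<^bsub>clifford I s\<^esub> x"])

text \<open>An element and its negative have the same square, hence the factor 2.\<close>

lemma card_clifford_involutions:
  "card {x \<in> carrier (clifford {..<n} s). x \<otimes>\<^bsub>clifford {..<n} s\<^esub> x = \<one>\<^bsub>clifford {..<n} s\<^esub>} =
    2 * card {S \<in> Pow {..<n}. \<not> tw s S S}"
proof -
  let ?T = "{S \<in> Pow {..<n}. \<not> tw s S S}"
  have fin: "finite S" if "S \<in> ?T" for S
    using that by (auto intro: finite_subset)
  have "bij_betw (\<lambda>x. (neg x, supp x)) {x. supp x \<in> ?T} (UNIV \<times> ?T)"
    by (rule bij_betw_byWitness[where f' = "\<lambda>(a, S). enc a S"]) (use fin in auto)
  then have "card {x. supp x \<in> ?T} = card ((UNIV :: bool set) \<times> ?T)"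
    by (rule bij_betw_same_card)
  moreover have "{x \<in> carrier (clifford {..<n} s). x \<otimes>\<^bsub>clifford {..<n} s\<^esub> x = \<one>\<^bsub>clifford {..<n} s\<^esub>} =
      {x. supp x \<in> ?T}"
    by (simp add: clifford_square_one clifford_carrier)
  ultimately show ?thesis by (simp add: card_cartesian_product)
qed

text \<open>Weighting the odd-length products by the imaginary unit makes the signed count of
  squares multiplicative in the generators.\<close>

lemma sum_tw_complex:
  "(\<Sum>S\<in>Pow {..<n}. (if tw s S S then -1 else 1) * (if odd (card S) then \<i> else 1)) =
    (\<Prod>i<n. if s i then 1 - \<i> else 1 + \<i>)"
proof (induction n)
  case (Suc n)
  let ?g = "\<lambda>S. (if tw s S S then -1 else 1) * (if odd (card S) then \<i> else 1) :: complex"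
  \<comment> \<open>Adjoining \<open>n\<close> costs a sign (-1)^|S| for the swaps. The weight
    absorbs it: from even to odd it changes by the factor i, from odd to even from i to 1 = -(i *
    i), so the total factor is i in both cases, up to the sign of \<open>s n\<close>.\<close>
  have ins: "?g (insert n S) = (if s n then - \<i> else \<i>) * ?g S" if "S \<in> Pow {..<n}" for S
  proof -
    have "finite S" "n \<notin> S" using that by (auto intro: finite_subset)
    then show ?thesis by (simp add: tw_insert_self)
  qed
  have inj: "inj_on (insert n) (Pow {..<n})"
    by (intro inj_onI) (metis PowD insert_ident lessThan_iff less_irrefl subsetD)
  have "sum ?g (Pow {..<Suc n}) = sum ?g (Pow {..<n}) + sum ?g (insert n ` Pow {..<n})"
    unfolding lessThan_Suc Pow_insert by (rule sum.union_disjoint) auto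
  also have "sum ?g (insert n ` Pow {..<n}) = (\<Sum>S\<in>Pow {..<n}. ?g (insert n S))"
    using sum.reindex[OF inj, of ?g] by (simp only: o_def)
  also have "\<dots> = (\<Sum>S\<in>Pow {..<n}. (if s n then - \<i> else \<i>) * ?g S)"
    by (rule sum.cong[OF refl ins])
  also have "\<dots> = (if s n then - \<i> else \<i>) * sum ?g (Pow {..<n})"
    by (rule sum_distrib_left[symmetric])
  finally show ?case unfolding Suc.IH by (simp add: algebra_simps)
qed (simp add: tw_def pairs_def)

text \<open>\<open>Re z + Im z\<close> is additive and sends both 1 and i to 1. It removes the
  auxiliary weight and leaves the number of products of square 1 minus the number of those of square
  -1.\<close>

definition signature_invariant :: "nat \<Rightarrow> nat \<Rightarrow> real" where
  "signature_invariant n q = (let z = (1 - \<i>) ^ q * (1 + \<i>) ^ (n - q) in Re z + Im z)"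

lemma signature_invariant_eq_card:
  assumes "q \<le> n"
  shows "signature_invariant n q = 2 * real (card {S \<in> Pow {..<n}. \<not> tw (\<lambda>i. i < q) S S}) - 2 ^ n"
proof -
  let ?t = "\<lambda>S. tw (\<lambda>i. i < q) S S"
  let ?z = "\<Sum>S\<in>Pow {..<n}. (if ?t S then -1 else 1) * (if odd (card S) then \<i> else 1)"
  have split: "{..<n} = {..<q} \<union> {q..<n}" using assms by auto
  have "?z = (\<Prod>i\<in>{..<q} \<union> {q..<n}. if i < q then 1 - \<i> else 1 + \<i>)"
    unfolding split[symmetric] by (rule sum_tw_complex)
  also have "\<dots> = (\<Prod>i<q. if i < q then 1 - \<i> else 1 + \<i>) * (\<Prod>i=q..<n. if i < q then 1 - \<i> else 1 + \<i>)"
    by (rule prod.union_disjoint) auto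
  also have "\<dots> = (1 - \<i>) ^ q * (1 + \<i>) ^ (n - q)" by simp
  finally have "signature_invariant n q = Re ?z + Im ?z"
    by (simp add: signature_invariant_def)
  also have "\<dots> = (\<Sum>S\<in>Pow {..<n}. if ?t S then -1 else 1)"
    unfolding Re_sum Im_sum sum.distrib[symmetric] by (rule sum.cong) auto
  also have "\<dots> = (\<Sum>S\<in>Pow {..<n}. 2 * of_bool (\<not> ?t S) - 1)"
    by (rule sum.cong) auto
  also have "\<dots> = 2 * (\<Sum>S\<in>Pow {..<n}. of_bool (\<not> ?t S)) - 2 ^ n"
    by (simp add: sum_subtractf sum_distrib_left card_Pow)
  also have "(\<Sum>S\<in>Pow {..<n}. of_bool (\<not> ?t S) :: real) = card {S \<in> Pow {..<n}. \<not> ?t S}"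
    by (simp add: of_bool_def sum.If_cases Int_def)
  finally show ?thesis .
qed

lemma signed_iso_signature_invariant:
  assumes "signed_iso (clifford {..<n} (\<lambda>i. i < q)) minus_one (clifford {..<n} (\<lambda>i. i < r)) minus_one"
    "q \<le> n" "r \<le> n"
  shows "signature_invariant n q = signature_invariant n r"
  using signed_iso_card_involutions[OF assms(1) group_clifford group_clifford] assms(2,3)
  by (simp add: card_clifford_involutions signature_invariant_eq_card)

lemma complex_power_pairing: "(1 - \<i>) ^ (k + a) * (1 + \<i>) ^ (k + b) = 2 ^ k * ((1 - \<i>) ^ a * (1 + \<i>) ^ b)"
proof -
  have "(1 - \<i>) * (1 + \<i>) = 2" by (simp add: algebra_simps)
  then have "(1 - \<i>) ^ k * (1 + \<i>) ^ k = 2 ^ k" by (simp only: power_mult_distrib[symmetric])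
  moreover have "(1 - \<i>) ^ (k + a) * (1 + \<i>) ^ (k + b) =
      ((1 - \<i>) ^ k * (1 + \<i>) ^ k) * ((1 - \<i>) ^ a * (1 + \<i>) ^ b)"
    by (simp only: power_add ac_simps)
  ultimately show ?thesis by (simp only:)
qed

text \<open>A negative and a positive term together contribute (1-i)(1+i) = 2, a positive real
  factor. Removing such pairs reduces the comparison of invariants to lengths 2 and 3.\<close>

lemma signature_invariant_pairing:
  "signature_invariant (2 * k + a + b) (k + a) = 2 ^ k * signature_invariant (a + b) a"
proof -
  have "2 * k + a + b - (k + a) = k + b" by simp
  then have "signature_invariant (2 * k + a + b) (k + a) =
      (let z = complex_of_real (2 ^ k) * ((1 - \<i>) ^ a * (1 + \<i>) ^ b) in Re z + Im z)"
    by (simp only: signature_invariant_def complex_power_pairing of_real_power of_real_numeral)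
  also have "\<dots> = 2 ^ k * signature_invariant (a + b) a"
    unfolding signature_invariant_def Let_def add_diff_cancel_left'
    by (simp add: distrib_left)
  finally show ?thesis .
qed

lemma signature_invariant_small:
  "signature_invariant 2 1 = 2" "signature_invariant 2 2 = - 2"
  "signature_invariant 3 1 = 4" "signature_invariant 3 2 = 0" "signature_invariant 3 3 = - 4"
  by (simp_all add: signature_invariant_def Let_def power2_eq_square power3_eq_cube)

lemma signature_invariant_even:
  "signature_invariant (2 * k + 2) (k + 1) = 2 ^ k * 2" "signature_invariant (2 * k + 2) (k + 2) = 2 ^ k * - 2"
  using signature_invariant_pairing[of k 1 1] signature_invariant_pairing[of k 2 0]
  by (simp_all add: signature_invariant_small del: One_nat_def)

lemma signature_invariant_odd:
  "signature_invariant (2 * k + 3) (k + 1) = 2 ^ k * 4" "signature_invariant (2 * k + 3) (k + 2) = 0"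
  "signature_invariant (2 * k + 3) (k + 3) = 2 ^ k * - 4"
  using signature_invariant_pairing[of k 1 2] signature_invariant_pairing[of k 2 1]
    signature_invariant_pairing[of k 3 0]
  by (simp_all add: signature_invariant_small add.assoc del: One_nat_def add_2_eq_Suc add_2_eq_Suc')

section \<open>The infinite case\<close>

lemma ex_bij_betw_infinite_nat:
  assumes "infinite A" "infinite (B :: nat set)"
  shows "\<exists>f. bij_betw f (A :: nat set) B"
  using bij_betw_trans[OF bij_betw_inv_into[OF bij_enumerate[OF assms(1)]] bij_enumerate[OF assms(2)]]
  by blast

text \<open>The signature \<open>odd\<close> merely stands for infinitely many terms of either kind.
  If one kind is finite in number, flipping infinitely many blocks while leaving infinitely many
  others alone produces both; a permutation does the rest.\<close>

lemma ac_generator_sig_infinite: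
  assumes sg: "signed_group G m" and gen: "has_ac_generator G m UNIV"
  shows "\<exists>e. ac_generator_sig G m e UNIV odd"
proof -
  obtain e s where e: "ac_generator_sig G m e UNIV s"
    using has_ac_generator_sig[OF sg gen] by blast
  have "\<exists>e s. ac_generator_sig G m e UNIV s \<and> infinite {i. s i} \<and> infinite {i. \<not> s i}"
  proof (cases "infinite {i. s i} \<and> infinite {i. \<not> s i}")
    case True
    then show ?thesis using e by blast
  next
    case False
    then obtain b where "finite {i. s i \<noteq> b}"
    proof (cases "finite {i. s i}")
      case True
      then show thesis using that[of False] by simp
    qed (use False that[of True] in simp)
    then obtain c where sub: "{i. s i \<noteq> b} \<subseteq> {..<c}"
      unfolding finite_nat_iff_bounded by (rule exE)
    have c: "s i = b" if "c \<le> i" for i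
    proof (rule ccontr)
      assume "s i \<noteq> b"
      then have "i \<in> {..<c}" using sub by blast
      then show False using that by simp
    qed
    \<comment> \<open>Beyond \<open>c\<close> every block has constant signature \<open>b\<close>.
      Flipping only those with even number leaves the odd-numbered ones at \<open>b\<close>.\<close>
    define J where "J = {k. even k \<and> c \<le> 4 * k}"
    let ?s = "\<lambda>i. s i \<noteq> (i div 4 \<in> J)"
    have "\<exists>e. ac_generator_sig G m e UNIV ?s"
    proof (rule ac_generator_sig_flip_blocks[OF sg e])
      show "s i = s (4 * (i div 4))" if "i div 4 \<in> J" for i
      proof -
        have "c \<le> 4 * (i div 4)" using that by (simp add: J_def)
        moreover have "4 * (i div 4) \<le> i" by simp
        ultimately show ?thesis using c[of i] c[of "4 * (i div 4)"] by linarith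
      qed
    qed simp
    moreover have "infinite {i. ?s i = d}" for d
      unfolding infinite_nat_iff_unbounded
    proof
      fix j
      \<comment> \<open>A multiple of 8 starts an even-numbered block, which is flipped away from
        \<open>b\<close>; adding 4 moves to the next block, which is not flipped. The summand
        \<open>c + j + 1\<close> puts the index beyond both \<open>c\<close> and
        \<open>j\<close>.\<close>
      let ?i = "8 * (c + j + 1) + (if d = b then 4 else 0)"
      have "s ?i = b" by (rule c) simp
      moreover have "?i div 4 = 2 * (c + j + 1) + (if d = b then 1 else 0)" by simp
      then have "?i div 4 \<in> J \<longleftrightarrow> d \<noteq> b" by (simp only: J_def mem_Collect_eq) auto
      ultimately have "?s ?i = d" by (simp only:) blast
      then show "\<exists>i>j. i \<in> {i. ?s i = d}" by (intro exI[of _ ?i]) simp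
    qed
    from this[of True] this[of False]
    have "infinite {i. ?s i}" "infinite {i. \<not> ?s i}" by simp_all
    ultimately show ?thesis by blast
  qed
  then obtain e s where e: "ac_generator_sig G m e UNIV s"
    and inf: "infinite {i \<in> UNIV. s i}" "infinite {i \<in> UNIV. \<not> s i}" by auto
  have unb: "infinite {i \<in> UNIV. odd (i :: nat)}" "infinite {i \<in> UNIV. \<not> odd (i :: nat)}"
  proof -
    have "infinite {i \<in> UNIV. odd (i :: nat) = d}" for d
      unfolding infinite_nat_iff_unbounded
    proof
      fix m :: nat
      show "\<exists>i>m. i \<in> {i \<in> UNIV. odd i = d}"
        by (intro exI[of _ "2 * m + (if d then 1 else 2)"]) simp
    qed
    from this[of True] this[of False]
    show "infinite {i \<in> UNIV. odd (i :: nat)}" "infinite {i \<in> UNIV. \<not> odd (i :: nat)}" by simp_all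
  qed
  obtain f where "bij_betw f {i \<in> UNIV. odd (i :: nat)} {i \<in> UNIV. s i}"
    using ex_bij_betw_infinite_nat[OF unb(1) inf(1)] by (rule exE)
  moreover obtain g where "bij_betw g {i \<in> UNIV. \<not> odd (i :: nat)} {i \<in> UNIV. \<not> s i}"
    using ex_bij_betw_infinite_nat[OF unb(2) inf(2)] by (rule exE)
  ultimately show ?thesis by (rule ac_generator_sig_permute[OF sg e])
qed

section \<open>Assembling the classification\<close>

lemma has_ac_generator_clifford: "has_ac_generator (clifford I s) minus_one I"
  using clifford_generator unfolding has_ac_generator_def ac_generator_sig_def by blast

lemma signed_iso_normal_form:
  assumes sg: "signed_group G m" and gen: "has_ac_generator G m {..<n}" and n: "2 \<le> n"
  obtains q where "n div 2 \<le> q" "q \<le> n - n div 2 + 1"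
    "signed_iso G m (clifford {..<n} (\<lambda>i. i < q)) minus_one"
  using ac_generator_sig_normal_form[OF assms] signed_iso_clifford[OF sg] by metis

theorem theorem4p3:
  shows
  "(\<forall>n::nat. n \<ge> 2 \<and> even n \<longrightarrow>
      (\<exists>(G1::nat monoid) m1 (G2::nat monoid) m2.
         signed_group G1 m1 \<and> has_ac_generator G1 m1 {..<n} \<and>
         signed_group G2 m2 \<and> has_ac_generator G2 m2 {..<n} \<and>
         \<not> signed_iso G1 m1 G2 m2 \<and>
         (\<forall>(G::'a monoid) m. signed_group G m \<and> has_ac_generator G m {..<n} \<longrightarrow>
             signed_iso G m G1 m1 \<or> signed_iso G m G2 m2)))
   \<and>
   (\<forall>n::nat. n \<ge> 2 \<and> odd n \<longrightarrow>
      (\<exists>(G1::nat monoid) m1 (G2::nat monoid) m2 (G3::nat monoid) m3.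
         signed_group G1 m1 \<and> has_ac_generator G1 m1 {..<n} \<and>
         signed_group G2 m2 \<and> has_ac_generator G2 m2 {..<n} \<and>
         signed_group G3 m3 \<and> has_ac_generator G3 m3 {..<n} \<and>
         \<not> signed_iso G1 m1 G2 m2 \<and> \<not> signed_iso G1 m1 G3 m3 \<and> \<not> signed_iso G2 m2 G3 m3 \<and>
         (\<forall>(G::'b monoid) m. signed_group G m \<and> has_ac_generator G m {..<n} \<longrightarrow>
             signed_iso G m G1 m1 \<or> signed_iso G m G2 m2 \<or> signed_iso G m G3 m3)))
   \<and>
   (\<exists>(G0::nat monoid) m0.
      signed_group G0 m0 \<and> has_ac_generator G0 m0 UNIV \<and>
      (\<forall>(G::'c monoid) m. signed_group G m \<and> has_ac_generator G m UNIV \<longrightarrow>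
          signed_iso G m G0 m0))"
proof -
  let ?C = "\<lambda>n q. clifford {..<n} (\<lambda>i. i < q)"
  have even: "signed_iso G m (?C n (k + 1)) minus_one \<or> signed_iso G m (?C n (k + 2)) minus_one"
    if gen: "signed_group G m" "has_ac_generator G m {..<n}" and n: "n = 2 * k + 2" for n k m and G :: "'a monoid"
  proof -
    have "2 \<le> n" using n by simp
    obtain q where q: "n div 2 \<le> q" "q \<le> n - n div 2 + 1" "signed_iso G m (?C n q) minus_one"
      using signed_iso_normal_form[OF gen \<open>2 \<le> n\<close>] by metis
    \<comment> \<open>For n = 2k+2 the window of the normal form has width 2. For n = 2k+3 below,
      rounding in \<open>n div 2\<close> widens it to three values.\<close>
    then have "q = k + 1 \<or> q = k + 2" using n by linarith
    then show ?thesis using q(3) by blast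
  qed
  have odd: "signed_iso G m (?C n (k + 1)) minus_one \<or> signed_iso G m (?C n (k + 2)) minus_one \<or>
      signed_iso G m (?C n (k + 3)) minus_one"
    if gen: "signed_group G m" "has_ac_generator G m {..<n}" and n: "n = 2 * k + 3" for n k m and G :: "'b monoid"
  proof -
    have "2 \<le> n" using n by simp
    obtain q where q: "n div 2 \<le> q" "q \<le> n - n div 2 + 1" "signed_iso G m (?C n q) minus_one"
      using signed_iso_normal_form[OF gen \<open>2 \<le> n\<close>] by metis
    then have "q = k + 1 \<or> q = k + 2 \<or> q = k + 3" using n by linarith
    then show ?thesis using q(3) by blast
  qed
  have inf: "signed_iso G m (clifford UNIV odd) minus_one"
    if "signed_group G m" "has_ac_generator G m UNIV" for m and G :: "'c monoid"
    using ac_generator_sig_infinite[OF that] signed_iso_clifford[OF that(1)] by metis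
  have noniso: "\<not> signed_iso (?C n q) minus_one (?C n r) minus_one"
    if "signature_invariant n q \<noteq> signature_invariant n r" "q \<le> n" "r \<le> n" for n q r
    using signed_iso_signature_invariant[OF _ that(2,3)] that(1) by blast
  show ?thesis
  proof (intro conjI allI impI)
    fix n :: nat assume "2 \<le> n \<and> even n"
    then have "\<exists>k. n = 2 * k + 2" by presburger
    then obtain k where n: "n = 2 * k + 2" by (rule exE)
    have "\<not> signed_iso (?C n (k + 1)) minus_one (?C n (k + 2)) minus_one"
      by (rule noniso) (unfold n signature_invariant_even, simp_all)
    then show "\<exists>(G1::nat monoid) m1 (G2::nat monoid) m2.
         signed_group G1 m1 \<and> has_ac_generator G1 m1 {..<n} \<and>
         signed_group G2 m2 \<and> has_ac_generator G2 m2 {..<n} \<and>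
         \<not> signed_iso G1 m1 G2 m2 \<and>
         (\<forall>(G::'a monoid) m. signed_group G m \<and> has_ac_generator G m {..<n} \<longrightarrow>
             signed_iso G m G1 m1 \<or> signed_iso G m G2 m2)"
      by (intro exI[of _ "?C n (k + 1)"] exI[of _ "?C n (k + 2)"] exI[of _ minus_one] conjI allI impI
          signed_group_clifford has_ac_generator_clifford even[OF _ _ n]) (assumption | erule conjunct1 conjunct2)+
  next
    fix n :: nat assume "2 \<le> n \<and> odd n"
    then have "\<exists>k. n = 2 * k + 3" by presburger
    then obtain k where n: "n = 2 * k + 3" by (rule exE)
    have "\<not> signed_iso (?C n (k + 1)) minus_one (?C n (k + 2)) minus_one"
      "\<not> signed_iso (?C n (k + 1)) minus_one (?C n (k + 3)) minus_one"
      "\<not> signed_iso (?C n (k + 2)) minus_one (?C n (k + 3)) minus_one"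
      by (rule noniso; unfold n signature_invariant_odd; simp)+
    then show "\<exists>(G1::nat monoid) m1 (G2::nat monoid) m2 (G3::nat monoid) m3.
         signed_group G1 m1 \<and> has_ac_generator G1 m1 {..<n} \<and>
         signed_group G2 m2 \<and> has_ac_generator G2 m2 {..<n} \<and>
         signed_group G3 m3 \<and> has_ac_generator G3 m3 {..<n} \<and>
         \<not> signed_iso G1 m1 G2 m2 \<and> \<not> signed_iso G1 m1 G3 m3 \<and> \<not> signed_iso G2 m2 G3 m3 \<and>
         (\<forall>(G::'b monoid) m. signed_group G m \<and> has_ac_generator G m {..<n} \<longrightarrow>
             signed_iso G m G1 m1 \<or> signed_iso G m G2 m2 \<or> signed_iso G m G3 m3)"
      by (intro exI[of _ "?C n (k + 1)"] exI[of _ "?C n (k + 2)"] exI[of _ "?C n (k + 3)"] exI[of _ minus_one]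
          conjI allI impI signed_group_clifford has_ac_generator_clifford odd[OF _ _ n])
        (assumption | erule conjunct1 conjunct2)+
  next
    show "\<exists>(G0::nat monoid) m0.
      signed_group G0 m0 \<and> has_ac_generator G0 m0 UNIV \<and>
      (\<forall>(G::'c monoid) m. signed_group G m \<and> has_ac_generator G m UNIV \<longrightarrow>
          signed_iso G m G0 m0)"
      using inf signed_group_clifford has_ac_generator_clifford by blast
  qed
qed

end
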